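(* Let $f:\mathbb{R}\times\mathbb{R}^m\to\mathbb{R}^m$ be sufficiently smooth, and suppose that the initial value problem $\dot u(t)=f(t,u(t))$, $u(0)=u_0$, has $\ell\ge1$ smooth conserved quantities $G=(G_1,\dots,G_\ell)^T:\mathbb{R}^m\to\mathbb{R}^\ell$. Let $(A,\vec b^{\,1},\dots,\vec b^{\,\ell})$ be the coefficients of a set of $\ell$ embedded $s$-stage Runge-Kutta methods, where $(A,\vec b^{\,1})$ has order $p\ge2$ and $(A,\vec b^{\,i})$ has order $p_i\ge1$ for $i=2,\dots,\ell$. Consider the generalized (multiple) relaxation method $$u^{n+1}_{\vec\gamma}=u^{n+1}+\Delta t\sum_{i=1}^\ell\gamma_i d_i^n,\qquad u^{n+1}=u^n+\Delta t\,d_1^n,\qquad d_k^n=\sum_{j=1}^s b_j^k f(t_n+c_j\Delta t,g_j),$$ with stages $g_i=u^n+\Delta t\sum_{j=1}^s a_{ij}f(t_n+c_j\Delta t,g_j)$, $i=1,\dots,s$, where $\vec\gamma=(\gamma_1,\dots,\gamma_\ell)\in\mathbb{R}^\ell$ (depending on $\Delta t$) satisfies $$G(u^{n+1}_{\vec\gamma})=G(u^n),$$ and assume $\vec\gamma=\mathcal{O}(\Delta t^{p-1})$ as $\Delta t\to0$. Put $\Gamma=\sum_{i=1}^\ell\gamma_i$ and $t^{n+1}_{\vec\gamma}=t_n+(1+\Gamma)\Delta t$. Then: (1) If $u^{n+1}_{\vec\gamma}$ is interpreted as an approximation to $u(t_n+\Delta t)$, the method has order $p-1$. (2) If $u^{n+1}_{\vec\gamma}$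 is interpreted as an approximation to $u(t^{n+1}_{\vec\gamma})$, the method has order $p$.
   Context: Conserved quantities: $G$ is a vector of conserved quantities of the ODE if $G(u(t))$ is constant in $t$ along every solution. Runge-Kutta methods: an $s$-stage Runge-Kutta method $(A,\vec b)$ has $A=(a_{ij})\in\mathbb{R}^{s\times s}$, $\vec b\in\mathbb{R}^s$, and $\vec c=A\vec e$ with $\vec e=(1,\dots,1)^T\in\mathbb{R}^s$. Its update is $u^n+\Delta t\sum_j b_j f(t_n+c_j\Delta t,g_j)$ with stages $g_i$ as in the claim. (If $A$ is not strictly lower triangular, the stages are, for small $\Delta t$, the solution of the stage equations near $u^n$.) A set $(A,\vec b^{\,1},\dots,\vec b^{\,\ell})$ is embedded if all methods share the same matrix $A$ and have weight vectors $\vec b^{\,k}=(b_1^k,\dots,b_s^k)^T$. Order: order is understood through the local (one-step) error. A one-step method whose update is interpreted as an approximation to $u(\tau)$, where $\tau=\tau(\Delta t)$ is the designated new time, has order $q$ if, for sufficiently smooth $f$ and assuming $u^n=u(t_n)$ exactly, the update equals $u(\tau)+\mathcal{O}(\Delta t^{q+1})$ as $\Delta t\to0$. For a standard Runge-Kutta method $(A,\vec b^{\,k})$, $\tau=t_n+\Delta t$. *)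

theory Defs
  imports "HOL-Analysis.Analysis" "HOL-Library.Landau_Symbols"
begin

text \<open>Functions of class C^k on the whole space. Continuity of \<open>x \<mapsto> Df(x) v\<close> for each
  fixed \<open>v\<close> amounts to continuity of \<open>Df\<close>, since the domain is finite-dimensional.\<close>

primrec C_k :: "nat \<Rightarrow> ('a::euclidean_space \<Rightarrow> 'b::euclidean_space) \<Rightarrow> bool" where
  "C_k 0 f \<longleftrightarrow> continuous_on UNIV f"
| "C_k (Suc k) f \<longleftrightarrow>
     (\<forall>x. f differentiable (at x)) \<and> (\<forall>v. C_k k (\<lambda>x. frechet_derivative f (at x) v))"

definition ode_solution ::
  "(real \<Rightarrow> real^'m \<Rightarrow> real^'m) \<Rightarrow> (real \<Rightarrow> real^'m) \<Rightarrow> real set \<Rightarrow> bool" where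
  "ode_solution f u T \<longleftrightarrow> open T \<and> is_interval T \<and>
     (\<forall>t\<in>T. (u has_vector_derivative f t (u t)) (at t))"

definition conserved ::
  "(real \<Rightarrow> real^'m \<Rightarrow> real^'m) \<Rightarrow> (real^'m \<Rightarrow> real^'l) \<Rightarrow> bool" where
  "conserved f G \<longleftrightarrow>
     (\<forall>v J. ode_solution f v J \<longrightarrow> (\<forall>s\<in>J. \<forall>t\<in>J. G (v s) = G (v t)))"

definition rk_nodes :: "real^'s^'s \<Rightarrow> real^'s" where
  "rk_nodes A = A *v 1"

text \<open>A family of stages \<open>g h i\<close>, indexed by the step size \<open>h\<close>: for all small \<open>h > 0\<close> the
  stage equations hold, and the stages tend to \<open>y\<close> as \<open>h \<rightarrow> 0\<close>. The latter selects, for an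
  implicit method, the solution near \<open>y\<close>, which is unique for small \<open>h\<close> if \<open>f\<close> is C^1;
  for an explicit method it follows from the equations if \<open>f\<close> is continuous.\<close>

definition rk_stages ::
  "real^'s^'s \<Rightarrow> (real \<Rightarrow> real^'m \<Rightarrow> real^'m) \<Rightarrow> real \<Rightarrow> real^'m
     \<Rightarrow> (real \<Rightarrow> 's \<Rightarrow> real^'m) \<Rightarrow> bool" where
  "rk_stages A f t y g \<longleftrightarrow>
     (\<forall>\<^sub>F h in at_right 0. \<forall>i.
        g h i = y + h *\<^sub>R (\<Sum>j\<in>UNIV. A $ i $ j *\<^sub>R f (t + rk_nodes A $ j * h) (g h j))) \<and>
     (\<forall>i. ((\<lambda>h. g h i) \<longlongrightarrow> y) (at_right 0))"

text \<open>The slope \<open>d = \<Sum>\<^sub>j b\<^sub>j f(t + c\<^sub>j h, g\<^sub>j)\<close>.\<close>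

definition rk_slope ::
  "real^'s^'s \<Rightarrow> real^'s \<Rightarrow> (real \<Rightarrow> real^'m \<Rightarrow> real^'m) \<Rightarrow> real
     \<Rightarrow> (real \<Rightarrow> 's \<Rightarrow> real^'m) \<Rightarrow> real \<Rightarrow> real^'m" where
  "rk_slope A b f t g h = (\<Sum>j\<in>UNIV. b $ j *\<^sub>R f (t + rk_nodes A $ j * h) (g h j))"

text \<open>The update \<open>v h\<close>, read as an approximation to \<open>u (\<tau> h)\<close>, has a one-step error of
  \<open>O(h^(q+1))\<close>.\<close>

definition local_order ::
  "nat \<Rightarrow> (real \<Rightarrow> real^'m) \<Rightarrow> (real \<Rightarrow> real^'m) \<Rightarrow> (real \<Rightarrow> real) \<Rightarrow> bool" where
  "local_order q v u \<tau> \<longleftrightarrow>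
     (\<lambda>h. norm (v h - u (\<tau> h))) \<in> O[at_right 0](\<lambda>h. h ^ (q + 1))"

text \<open>Order (at least) \<open>q\<close> of the method \<open>(A, b)\<close>, for ODEs in dimension \<open>CARD('m)\<close>.
  ``For all sufficiently smooth \<open>f\<close>'' means for all \<open>f\<close> of class C^N, with some \<open>N\<close>
  that does not depend on \<open>f\<close>.\<close>

definition rk_order ::
  "'m::finite itself \<Rightarrow> real^'s^'s \<Rightarrow> real^'s \<Rightarrow> nat \<Rightarrow> bool" where
  "rk_order _ A b q \<longleftrightarrow>
     (\<exists>N. \<forall>(f :: real \<Rightarrow> real^'m \<Rightarrow> real^'m) u T t g.
        C_k N (\<lambda>(t, x). f t x) \<longrightarrow> ode_solution f u T \<longrightarrow> t \<in> T \<longrightarrow>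
        rk_stages A f t (u t) g \<longrightarrow>
        local_order q (\<lambda>h. u t + h *\<^sub>R rk_slope A b f t g h) u (\<lambda>h. t + h))"

end

theory Submission
  imports Defs
begin

text \<open>Write \<open>h\<close> for the step size and \<open>u' = f(t\<^sub>n, u(t\<^sub>n))\<close>. Two facts carry the proof.

  First, along a solution of an equation with \<open>C\<^sup>1\<close> right-hand side the slope \<open>f(t, u(t))\<close> is a
  differentiable function of \<open>t\<close>, so that \<open>u(x) - u(y) = (x - y) u' + O(\<bar>x - y\<bar> r)\<close> for \<open>x, y\<close>
  within a small distance \<open>r\<close> of \<open>t\<^sub>n\<close> (\<open>solution_increment_bound\<close>). Second, an embedded method of
  order at least 1 has \<open>h d\<^sub>i = u(t\<^sub>n + h) - u(t\<^sub>n) + O(h\<^sup>2) = h u' + O(h\<^sup>2)\<close>, that is,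
  \<open>d\<^sub>i = u' + O(h)\<close> (\<open>rk_slope_approximates_derivative\<close>).

  As \<open>\<gamma>\<^sub>i = O(h\<^bsup>p-1\<^esup>)\<close>, the relaxation term is therefore \<open>h \<Sum>\<gamma>\<^sub>i d\<^sub>i = h \<Gamma> u' + O(h\<^bsup>p+1\<^esup>)\<close>. All the
  directions \<open>d\<^sub>i\<close> agree to leading order with the direction of the flow, so to within the error
  of the base method the relaxation moves the numerical solution along the exact trajectory, by the
  time \<open>h \<Gamma>\<close>. Read at \<open>t\<^sub>n + h\<close>, this shift is an error of size \<open>h \<Gamma> = O(h\<^bsup>p\<^esup>)\<close> and costs one order.
  Read at \<open>t\<^sub>n + (1 + \<Gamma>) h\<close>, it is compensated by
  \<open>u(t\<^sub>n + (1 + \<Gamma>) h) - u(t\<^sub>n + h) = h \<Gamma> u' + O(h\<^bsup>p+1\<^esup>)\<close>, and the order \<open>p\<close> of the base method is kept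
  (\<open>relaxation_local_order\<close>).\<close>

lemma C_k_SucD: "C_k (Suc k) f \<Longrightarrow> C_k k f"
proof (induction k arbitrary: f)
  case 0
  then have "\<And>x. f differentiable (at x)" by simp
  then show ?case
    by (simp add: continuous_on_eq_continuous_at differentiable_imp_continuous_within)
next
  case (Suc k)
  then show ?case
    by (metis C_k.simps(2))
qed

lemma C_k_antimono:
  assumes "k \<le> n" and "C_k n f"
  shows "C_k k f"
  using assms by (induction n rule: dec_induct) (auto dest: C_k_SucD simp del: C_k.simps)

lemma bigo_norm_le:
  fixes x :: "real \<Rightarrow> 'a::real_normed_vector"
  assumes "y \<in> O[F](g)" and "\<forall>\<^sub>F h in F. norm (x h) \<le> C * norm (y h)"
  shows "(\<lambda>h. norm (x h)) \<in> O[F](g)"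
proof -
  have "(\<lambda>h. norm (x h)) \<in> O[F](y)"
    using assms(2) by (intro bigoI[of _ C]) simp
  then show ?thesis
    using assms(1) landau_o.big_trans by blast
qed

lemma bigo_norm_add:
  fixes x y :: "real \<Rightarrow> 'a::real_normed_vector"
  assumes "(\<lambda>h. norm (x h)) \<in> O[F](g)" and "(\<lambda>h. norm (y h)) \<in> O[F](g)"
  shows "(\<lambda>h. norm (x h + y h)) \<in> O[F](g)"
  using sum_in_bigo(1)[OF assms]
  by (rule bigo_norm_le[where C = 1]) (auto simp: norm_triangle_ineq)

lemma bigo_norm_diff:
  fixes x y :: "real \<Rightarrow> 'a::real_normed_vector"
  assumes "(\<lambda>h. norm (x h)) \<in> O[F](g)" and "(\<lambda>h. norm (y h)) \<in> O[F](g)"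
  shows "(\<lambda>h. norm (x h - y h)) \<in> O[F](g)"
  using bigo_norm_add[of x F g "\<lambda>h. - y h"] assms by simp

lemma bigo_norm_sum:
  fixes x :: "'i \<Rightarrow> real \<Rightarrow> 'a::real_normed_vector"
  assumes "\<And>i. i \<in> I \<Longrightarrow> (\<lambda>h. norm (x i h)) \<in> O[F](g)"
  shows "(\<lambda>h. norm (\<Sum>i\<in>I. x i h)) \<in> O[F](g)"
  using assms
  by (induction I rule: infinite_finite_induct) (auto intro!: bigo_norm_add)

lemma bigo_norm_scaleR:
  fixes x :: "real \<Rightarrow> 'a::real_normed_vector" and c :: "real \<Rightarrow> real"
  assumes "c \<in> O[F](a)" and "(\<lambda>h. norm (x h)) \<in> O[F](g)"
  shows "(\<lambda>h. norm (c h *\<^sub>R x h)) \<in> O[F](\<lambda>h. a h * g h)"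
  using landau_o.big.mult[OF assms]
  by (rule bigo_norm_le[where C = 1]) (auto simp: abs_mult)

lemma bigo_power_at_right_0:
  assumes "m \<le> n"
  shows "(\<lambda>h::real. h ^ n) \<in> O[at_right 0](\<lambda>h. h ^ m)"
proof (rule bigoI[of _ 1])
  have "\<forall>\<^sub>F h::real in at_right 0. h < 1"
    by (intro order_tendstoD(2)[OF tendsto_ident_at]) simp
  then show "\<forall>\<^sub>F h::real in at_right 0. norm (h ^ n) \<le> 1 * norm (h ^ m)"
    using eventually_at_right_less[of 0]
    by eventually_elim (simp add: assms power_decreasing)
qed

lemma differentiable_imp_Lipschitz_at_point:
  fixes w :: "real \<Rightarrow> 'a::real_normed_vector"
  assumes "w differentiable (at t0)"
  obtains K \<delta> where "K \<ge> 0" "\<delta> > 0"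
    "\<And>t. \<bar>t - t0\<bar> < \<delta> \<Longrightarrow> norm (w t - w t0) \<le> K * \<bar>t - t0\<bar>"
proof -
  obtain w' where w': "(w has_derivative w') (at t0)"
    using assms unfolding differentiable_def by blast
  then have "bounded_linear w'"
    by (rule has_derivative_bounded_linear)
  then obtain B where B: "\<And>x. norm (w' x) \<le> norm x * B" "B \<ge> 0"
    using bounded_linear.nonneg_bounded by metis
  obtain \<delta> where \<delta>: "\<delta> > 0"
    "\<And>t. norm (t - t0) < \<delta> \<Longrightarrow> norm (w t - w t0 - w' (t - t0)) \<le> 1 * norm (t - t0)"
    using w' unfolding has_derivative_at_alt by (metis zero_less_one)
  have "norm (w t - w t0) \<le> (B + 1) * \<bar>t - t0\<bar>" if "\<bar>t - t0\<bar> < \<delta>" for t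
    using norm_triangle_sub[of "w t - w t0" "w' (t - t0)"] \<delta>(2)[of t] B(1)[of "t - t0"] that
    by (simp add: algebra_simps)
  then show ?thesis
    using that[of "B + 1" \<delta>] B \<delta> by auto
qed

text \<open>Subtracting the linear function \<open>t \<mapsto> t *\<^sub>R f t0 (u t0)\<close> from \<open>u\<close> leaves a function whose
  derivative vanishes at \<open>t0\<close> and is \<open>O(\<bar>t - t0\<bar>)\<close> nearby; the mean value inequality does the
  rest. Leaving both end points free, rather than fixing one of them at \<open>t0\<close>, is what allows
  the solution to be compared at the times \<open>t0 + h\<close> and \<open>t0 + (1 + \<Gamma>) h\<close>.\<close>

lemma solution_increment_bound:
  fixes f :: "real \<Rightarrow> real^'m \<Rightarrow> real^'m"
  assumes f: "C_k 1 (\<lambda>(t, x). f t x)" and u: "ode_solution f u T" and t0: "t0 \<in> T"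
  obtains K \<delta> where "K \<ge> 0" "\<delta> > 0"
    "\<And>x y r. r < \<delta> \<Longrightarrow> \<bar>x - t0\<bar> \<le> r \<Longrightarrow> \<bar>y - t0\<bar> \<le> r \<Longrightarrow>
       norm (u x - u y - (x - y) *\<^sub>R f t0 (u t0)) \<le> \<bar>x - y\<bar> * (K * r)"
proof -
  have deriv: "(u has_vector_derivative f t (u t)) (at t)" if "t \<in> T" for t
    using u that unfolding ode_solution_def by blast
  have "(\<lambda>(t, x). f t x) differentiable (at z)" for z
    using f unfolding One_nat_def C_k.simps by blast
  moreover have "(\<lambda>t. (t, u t)) differentiable (at t0)"
    using has_derivative_Pair[OF has_derivative_ident deriv[OF t0, unfolded has_vector_derivative_def]]
    by (rule differentiableI)
  ultimately have "((\<lambda>(t, x). f t x) \<circ> (\<lambda>t. (t, u t))) differentiable (at t0)"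
    by (intro differentiable_chain_at)
  then have "(\<lambda>t. f t (u t)) differentiable (at t0)"
    by (simp add: o_def)
  then obtain K \<delta> where K: "K \<ge> 0" "\<delta> > 0"
    "\<And>t. \<bar>t - t0\<bar> < \<delta> \<Longrightarrow> norm (f t (u t) - f t0 (u t0)) \<le> K * \<bar>t - t0\<bar>"
    using differentiable_imp_Lipschitz_at_point by blast
  obtain e where e: "e > 0" "ball t0 e \<subseteq> T"
    using u t0 unfolding ode_solution_def by (meson open_contains_ball)
  have "norm (u x - u y - (x - y) *\<^sub>R f t0 (u t0)) \<le> \<bar>x - y\<bar> * (K * r)"
    if r: "r < min \<delta> e" and x: "\<bar>x - t0\<bar> \<le> r" and y: "\<bar>y - t0\<bar> \<le> r" for x y r
  proof -
    let ?D = "\<lambda>t. u t - t *\<^sub>R f t0 (u t0)"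
    have "norm (?D x - ?D y) \<le> (K * r) * norm (x - y)"
    proof (rule differentiable_bound)
      show "convex (cball t0 r)" by simp
      fix t assume "t \<in> cball t0 r"
      then have t: "\<bar>t - t0\<bar> \<le> r" by (simp add: dist_real_def abs_minus_commute)
      then have "t \<in> T"
        using r e by (auto simp: dist_real_def subset_iff)
      then have "(?D has_derivative (\<lambda>s. s *\<^sub>R f t (u t) - s *\<^sub>R f t0 (u t0))) (at t)"
        by (intro has_derivative_diff has_derivative_scaleR_left has_derivative_ident
            deriv[unfolded has_vector_derivative_def])
      then show "(?D has_derivative (\<lambda>s. s *\<^sub>R (f t (u t) - f t0 (u t0)))) (at t within cball t0 r)"
        by (simp add: scaleR_diff_right has_derivative_at_withinI)
      have "norm (f t (u t) - f t0 (u t0)) \<le> K * r"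
        using K(3)[of t] t r K(1) mult_left_mono[OF t K(1)] by simp
      then show "onorm (\<lambda>s. s *\<^sub>R (f t (u t) - f t0 (u t0))) \<le> K * r"
        by (intro onorm_le) (simp add: mult_left_mono mult.commute[of "K * r"])
    qed (use x y in \<open>auto simp: dist_real_def abs_minus_commute\<close>)
    then show ?thesis
      by (simp add: algebra_simps)
  qed
  then show ?thesis
    using that[of K "min \<delta> e"] K e by simp
qed

lemma solution_first_order_expansion:
  fixes f :: "real \<Rightarrow> real^'m \<Rightarrow> real^'m"
  assumes f: "C_k 1 (\<lambda>(t, x). f t x)" and u: "ode_solution f u T" and t0: "t0 \<in> T"
    and \<alpha>: "\<alpha> \<in> O[at_right 0](\<lambda>h. h)" and \<beta>: "\<beta> \<in> O[at_right 0](\<lambda>h. h)"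
    and diff: "(\<lambda>h. \<alpha> h - \<beta> h) \<in> O[at_right 0](g)"
  shows "(\<lambda>h. norm (u (t0 + \<alpha> h) - u (t0 + \<beta> h) - (\<alpha> h - \<beta> h) *\<^sub>R f t0 (u t0)))
           \<in> O[at_right 0](\<lambda>h. g h * h)"
proof -
  obtain K \<delta> where K: "K \<ge> 0" "\<delta> > 0"
    "\<And>x y r. r < \<delta> \<Longrightarrow> \<bar>x - t0\<bar> \<le> r \<Longrightarrow> \<bar>y - t0\<bar> \<le> r \<Longrightarrow>
       norm (u x - u y - (x - y) *\<^sub>R f t0 (u t0)) \<le> \<bar>x - y\<bar> * (K * r)"
    using solution_increment_bound[OF f u t0] by blast
  define r where "r h = \<bar>\<alpha> h\<bar> + \<bar>\<beta> h\<bar>" for h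
  have r: "r \<in> O[at_right 0](\<lambda>h. h)"
    unfolding r_def[abs_def] using \<alpha> \<beta> by (intro sum_in_bigo) simp_all
  also have "(\<lambda>h::real. h) \<in> o[at_right 0](\<lambda>_. 1)"
    by (intro smalloI_tendsto) simp_all
  finally have "(r \<longlongrightarrow> 0) (at_right 0)"
    using smalloD_tendsto[of r "at_right 0" "\<lambda>_. 1"] by simp
  then have "\<forall>\<^sub>F h in at_right 0. r h < \<delta>"
    using K(2) by (rule order_tendstoD)
  then have "\<forall>\<^sub>F h in at_right 0.
      norm (u (t0 + \<alpha> h) - u (t0 + \<beta> h) - (\<alpha> h - \<beta> h) *\<^sub>R f t0 (u t0))
        \<le> K * norm ((\<alpha> h - \<beta> h) * r h)"
  proof eventually_elim
    case (elim h)
    have "r h \<ge> 0" by (simp add: r_def)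
    then show ?case
      using K(3)[OF elim, of "t0 + \<alpha> h" "t0 + \<beta> h"]
      by (simp add: r_def abs_mult mult_ac)
  qed
  then show ?thesis
    by (rule bigo_norm_le[OF landau_o.big.mult[OF diff r]])
qed

text \<open>Dividing the one-step error by \<open>h\<close> turns order at least 1 into consistency of the slope:
  the update agrees with \<open>u (t0 + h)\<close>, and this with \<open>u t0 + h *\<^sub>R f t0 (u t0)\<close>, both up to
  \<open>O(h^2)\<close>.\<close>

lemma rk_slope_approximates_derivative:
  fixes f :: "real \<Rightarrow> real^'m \<Rightarrow> real^'m"
  assumes f: "C_k 1 (\<lambda>(t, x). f t x)" and u: "ode_solution f u T" and t0: "t0 \<in> T"
    and order: "local_order q (\<lambda>h. u t0 + h *\<^sub>R d h) u (\<lambda>h. t0 + h)" and q: "q \<ge> 1"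
  shows "(\<lambda>h. norm (d h - f t0 (u t0))) \<in> O[at_right 0](\<lambda>h. h)"
proof -
  have "(\<lambda>h. norm (u t0 + h *\<^sub>R d h - u (t0 + h))) \<in> O[at_right 0](\<lambda>h. h ^ (q + 1))"
    using order by (simp add: local_order_def)
  also have "(\<lambda>h::real. h ^ (q + 1)) \<in> O[at_right 0](\<lambda>h. h ^ 2)"
    using q by (intro bigo_power_at_right_0) simp
  finally have "(\<lambda>h. norm (u t0 + h *\<^sub>R d h - u (t0 + h))) \<in> O[at_right 0](\<lambda>h. h * h)"
    by (simp add: power2_eq_square)
  moreover have "(\<lambda>h. norm (u (t0 + h) - u t0 - h *\<^sub>R f t0 (u t0))) \<in> O[at_right 0](\<lambda>h. h * h)"
    using solution_first_order_expansion[OF f u t0, of "\<lambda>h. h" "\<lambda>h. 0" "\<lambda>h. h"] by simp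
  ultimately have
    "(\<lambda>h. norm ((u t0 + h *\<^sub>R d h - u (t0 + h)) + (u (t0 + h) - u t0 - h *\<^sub>R f t0 (u t0))))
       \<in> O[at_right 0](\<lambda>h. h * h)"
    by (rule bigo_norm_add)
  then have "(\<lambda>h. norm (h *\<^sub>R (d h - f t0 (u t0)))) \<in> O[at_right 0](\<lambda>h. h * h)"
    by (simp add: algebra_simps)
  then have "(\<lambda>h. h * norm (d h - f t0 (u t0))) \<in> O[at_right 0](\<lambda>h. h * h)"
    by (subst landau_o.big.norm_iff[symmetric]) (simp add: abs_mult)
  moreover have "\<forall>\<^sub>F h::real in at_right 0. h \<noteq> 0"
    using eventually_at_right_less[of 0] by eventually_elim simp
  ultimately show ?thesis
    by (simp add: landau_o.big.mult_cancel_left)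
qed

text \<open>The order of the base step \<open>v\<close> and the consistency of all search directions \<open>d i\<close>
  determine the relaxed step \<open>w\<close> up to \<open>O(h^(p+1))\<close>: it is \<open>u (t0 + h)\<close> shifted by
  \<open>(\<Gamma> h * h) *\<^sub>R f t0 (u t0)\<close>. Both orders follow from this one expansion.\<close>

lemma relaxation_local_order:
  fixes f :: "real \<Rightarrow> real^'m \<Rightarrow> real^'m" and \<gamma> :: "real \<Rightarrow> real^'l::finite"
    and d :: "real \<Rightarrow> 'l \<Rightarrow> real^'m"
  assumes f: "C_k 1 (\<lambda>(t, x). f t x)" and u: "ode_solution f u T" and t0: "t0 \<in> T"
    and p: "p \<ge> 2"
    and v: "local_order p v u (\<lambda>h. t0 + h)"
    and d: "\<And>i. (\<lambda>h. norm (d h i - f t0 (u t0))) \<in> O[at_right 0](\<lambda>h. h)"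
    and \<gamma>: "(\<lambda>h. norm (\<gamma> h)) \<in> O[at_right 0](\<lambda>h. h ^ (p - 1))"
  defines "w \<equiv> (\<lambda>h. v h + h *\<^sub>R (\<Sum>i\<in>UNIV. \<gamma> h $ i *\<^sub>R d h i))"
    and "\<Gamma> \<equiv> (\<lambda>h. \<Sum>i\<in>UNIV. \<gamma> h $ i)"
  shows "local_order (p - 1) w u (\<lambda>h. t0 + h)"
    and "local_order p w u (\<lambda>h. t0 + (1 + \<Gamma> h) * h)"
proof -
  define u' where "u' = f t0 (u t0)"
  have pow: "h * h ^ (p - Suc 0) = h ^ p" "h * (h ^ (p - Suc 0) * h) = h * h ^ p" for h :: real
    using p by (cases p; simp)+
  have \<gamma>_i: "(\<lambda>h. \<gamma> h $ i) \<in> O[at_right 0](\<lambda>h. h ^ (p - 1))" for i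
    using bigo_norm_le[OF \<gamma>, of "\<lambda>h. \<gamma> h $ i" 1] component_le_norm_cart[of "\<gamma> _" i] by simp
  have \<Gamma>: "\<Gamma> \<in> O[at_right 0](\<lambda>h. h ^ (p - 1))"
    unfolding \<Gamma>_def using \<gamma>_i by (intro big_sum_in_bigo)
  have id: "(\<lambda>h::real. h) \<in> O[at_right 0](\<lambda>h. h)"
    by simp
  have h\<Gamma>: "(\<lambda>h. \<Gamma> h * h) \<in> O[at_right 0](\<lambda>h. h ^ p)"
    using landau_o.big.mult[OF id \<Gamma>]
    by (simp add: pow mult.commute)
  have base: "(\<lambda>h. norm (v h - u (t0 + h))) \<in> O[at_right 0](\<lambda>h. h ^ (p + 1))"
    using v by (simp add: local_order_def)
  have "(\<lambda>h. norm (\<Sum>i\<in>UNIV. \<gamma> h $ i *\<^sub>R (d h i - u'))) \<in> O[at_right 0](\<lambda>h. h ^ (p - 1) * h)"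
    unfolding u'_def by (intro bigo_norm_sum bigo_norm_scaleR \<gamma>_i d)
  then have "(\<lambda>h. norm (h *\<^sub>R (\<Sum>i\<in>UNIV. \<gamma> h $ i *\<^sub>R (d h i - u')))) \<in> O[at_right 0](\<lambda>h. h ^ (p + 1))"
    using bigo_norm_scaleR[OF id] by (fastforce simp: pow)
  from bigo_norm_add[OF base this]
  have main: "(\<lambda>h. norm (w h - u (t0 + h) - (\<Gamma> h * h) *\<^sub>R u')) \<in> O[at_right 0](\<lambda>h. h ^ (p + 1))"
    by (simp add: w_def \<Gamma>_def algebra_simps sum_subtractf scaleR_left.sum sum_distrib_left scaleR_sum_right)
  have "(\<lambda>h. norm ((\<Gamma> h * h) *\<^sub>R u')) \<in> O[at_right 0](\<lambda>h. h ^ p * 1)"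
    by (intro bigo_norm_scaleR h\<Gamma>) simp
  moreover have "(\<lambda>h. norm (w h - u (t0 + h) - (\<Gamma> h * h) *\<^sub>R u')) \<in> O[at_right 0](\<lambda>h. h ^ p)"
    by (rule landau_o.big_trans[OF main bigo_power_at_right_0]) simp
  ultimately have "(\<lambda>h. norm ((w h - u (t0 + h) - (\<Gamma> h * h) *\<^sub>R u') + (\<Gamma> h * h) *\<^sub>R u'))
      \<in> O[at_right 0](\<lambda>h. h ^ p)"
    by (intro bigo_norm_add) simp_all
  then show "local_order (p - 1) w u (\<lambda>h. t0 + h)"
    using p by (simp add: local_order_def)
  have "(\<lambda>h. \<Gamma> h * h) \<in> O[at_right 0](\<lambda>h. h)"
    using landau_o.big_trans[OF h\<Gamma>] bigo_power_at_right_0[of 1 p] p by simp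
  then have "(\<lambda>h. (1 + \<Gamma> h) * h) \<in> O[at_right 0](\<lambda>h. h)"
    using sum_in_bigo(1)[OF id] by (simp add: algebra_simps)
  then have "(\<lambda>h. norm (u (t0 + (1 + \<Gamma> h) * h) - u (t0 + h) - (\<Gamma> h * h) *\<^sub>R u'))
      \<in> O[at_right 0](\<lambda>h. h ^ (p + 1))"
    using solution_first_order_expansion[OF f u t0, of "\<lambda>h. (1 + \<Gamma> h) * h" "\<lambda>h. h" "\<lambda>h. h ^ p"] h\<Gamma>
    by (simp add: algebra_simps u'_def)
  from bigo_norm_diff[OF main this]
  show "local_order p w u (\<lambda>h. t0 + (1 + \<Gamma> h) * h)"
    by (simp add: local_order_def)
qed

theorem theorem4p2:
  fixes A :: "real^'s^'s"
    and b :: "'l::finite \<Rightarrow> real^'s"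
    and first :: 'l
    and p :: nat and q :: "'l \<Rightarrow> nat"
  assumes "p \<ge> 2" and "rk_order TYPE('m::finite) A (b first) p"
    and "\<And>i. i \<noteq> first \<Longrightarrow> q i \<ge> 1 \<and> rk_order TYPE('m) A (b i) (q i)"
  shows "\<exists>N. \<forall>(f :: real \<Rightarrow> real^'m \<Rightarrow> real^'m) (G :: real^'m \<Rightarrow> real^'l) u0 u T tn
             (g :: real \<Rightarrow> 's \<Rightarrow> real^'m) (\<gamma> :: real \<Rightarrow> real^'l) un d un1 ugam \<Gamma>.
      C_k N (\<lambda>(t, x). f t x) \<longrightarrow> C_k N G \<longrightarrow> conserved f G \<longrightarrow>
      ode_solution f u T \<longrightarrow> 0 \<in> T \<longrightarrow> u 0 = u0 \<longrightarrow>
      tn \<in> T \<longrightarrow> un = u tn \<longrightarrow>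
      rk_stages A f tn un g \<longrightarrow>
      d = (\<lambda>h k. rk_slope A (b k) f tn g h) \<longrightarrow>
      un1 = (\<lambda>h. un + h *\<^sub>R d h first) \<longrightarrow>
      ugam = (\<lambda>h. un1 h + h *\<^sub>R (\<Sum>i\<in>UNIV. \<gamma> h $ i *\<^sub>R d h i)) \<longrightarrow>
      (\<forall>\<^sub>F h in at_right 0. G (ugam h) = G un) \<longrightarrow>
      (\<lambda>h. norm (\<gamma> h)) \<in> O[at_right 0](\<lambda>h. h ^ (p - 1)) \<longrightarrow>
      \<Gamma> = (\<lambda>h. \<Sum>i\<in>UNIV. \<gamma> h $ i) \<longrightarrow>
      local_order (p - 1) ugam u (\<lambda>h. tn + h) \<and>
      local_order p ugam u (\<lambda>h. tn + (1 + \<Gamma> h) * h)"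
proof -
  \<comment> \<open>With the base method included, all weight vectors can be treated alike.\<close>
  define r where "r = q(first := p)"
  have r: "r first = p" "r i \<ge> 1" "rk_order TYPE('m) A (b i) (r i)" for i
    using assms unfolding r_def by auto
  obtain M where M: "\<And>i (f :: real \<Rightarrow> real^'m \<Rightarrow> real^'m) u T t g.
      C_k (M i) (\<lambda>(t, x). f t x) \<Longrightarrow> ode_solution f u T \<Longrightarrow> t \<in> T \<Longrightarrow> rk_stages A f t (u t) g \<Longrightarrow>
      local_order (r i) (\<lambda>h. u t + h *\<^sub>R rk_slope A (b i) f t g h) u (\<lambda>h. t + h)"
    using r(3) unfolding rk_order_def by metis
  \<comment> \<open>Smooth enough for every method of the set, and at least \<open>C\<^sup>1\<close> for the Taylor expansion of \<open>u\<close>.\<close>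
  define N where "N = Max (insert 1 (range M))"
  have N: "1 \<le> N" "M i \<le> N" for i
    unfolding N_def by (intro Max_ge; simp)+
  have "local_order (p - 1) w u (\<lambda>h. tn + h) \<and>
        local_order p w u (\<lambda>h. tn + (1 + (\<Sum>i\<in>UNIV. \<gamma> h $ i)) * h)"
    if f: "C_k N (\<lambda>(t, x). f t x)" and u: "ode_solution f u T" and tn: "tn \<in> T"
      and g: "rk_stages A f tn (u tn) g"
      and \<gamma>: "(\<lambda>h. norm (\<gamma> h)) \<in> O[at_right 0](\<lambda>h. h ^ (p - 1))"
      and w: "w = (\<lambda>h. u tn + h *\<^sub>R rk_slope A (b first) f tn g h
                 + h *\<^sub>R (\<Sum>i\<in>UNIV. \<gamma> h $ i *\<^sub>R rk_slope A (b i) f tn g h))"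
    for f :: "real \<Rightarrow> real^'m \<Rightarrow> real^'m" and u T tn g and \<gamma> :: "real \<Rightarrow> real^'l" and w
  proof -
    have f1: "C_k 1 (\<lambda>(t, x). f t x)"
      using N(1) f by (rule C_k_antimono)
    have order: "local_order (r i) (\<lambda>h. u tn + h *\<^sub>R rk_slope A (b i) f tn g h) u (\<lambda>h. tn + h)" for i
      using C_k_antimono[OF N(2) f] u tn g by (rule M)
    have slope: "(\<lambda>h. norm (rk_slope A (b i) f tn g h - f tn (u tn))) \<in> O[at_right 0](\<lambda>h. h)" for i
      using f1 u tn order r(2) by (rule rk_slope_approximates_derivative)
    show ?thesis
      unfolding w
      using relaxation_local_order[OF f1 u tn assms(1) order[of first, unfolded r(1)] _ \<gamma>,
          where d = "\<lambda>h i. rk_slope A (b i) f tn g h"] slope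
      by simp
  qed
  then show ?thesis
    by (intro exI[of _ N]) blast
qed

end
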